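(* Let $F\subset K^n$ be a $q$-variety. Then (1) every chain of irreducible $q$-varieties $F_0\subsetneq F_1\subsetneq\dots\subsetneq F_m\subset F$ has length $m\le n$; (2) all maximal such chains contained in $F$ have the same length. Defining $\dim F$ as the maximal length of such a chain, one has $\dim K^n=n$.
   Context: $p$ prime, $K$ algebraically closed of characteristic $p$, $q$ a power of $p$, $\mathbb{F}_q\subset K$. $K\{\tau\}$ is the ring (under composition) of $\mathbb{F}_q$-linear polynomials $\sum a_iX^{q^i}$. $\Lambda_n$ is the set of polynomials $\sum_{i=1}^nP_i(X_i)$, $P_i\in K\{\tau\}$. A $q$-variety in $K^n$ is a set $\{x\in K^n: f(x)=0\ \forall f\in S\}$, $S\subset\Lambda_n$. A $q$-variety $F$ is irreducible if the only sub-$q$-variety $H\subset F$ with $F/H$ finite is $F$ itself. A chain in $F$ is a sequence of irreducible $q$-varieties $F_0\subsetneq\dots\subsetneq F_m\subset F$, and $m$ is its length. *)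

theory Defs
  imports "HOL-Analysis.Finite_Cartesian_Product"
    "HOL-Computational_Algebra.Computational_Algebra"
begin

(* The underlying set of the ring K{tau}, where tau = X^q. *)
definition additive_polys :: "nat \<Rightarrow> ('a::field) poly set" where
  "additive_polys q = {\<Sum>i\<le>d. monom (a i) (q ^ i) | (d :: nat) (a :: nat \<Rightarrow> 'a). True}"

(* A polynomial P_1(X_1) + ... + P_n(X_n) is represented by the function it induces on K^n.
   This loses nothing, since K is infinite whenever it is algebraically closed. *)
definition Lambda :: "nat \<Rightarrow> (('a::field) ^ 'n \<Rightarrow> 'a) set" where
  "Lambda q = {\<lambda>x. \<Sum>i\<in>UNIV. poly (P i) (x $ i) | P. \<forall>i::'n. P i \<in> additive_polys q}"

definition q_variety :: "nat \<Rightarrow> (('a::field) ^ 'n) set \<Rightarrow> bool" where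
  "q_variety q V \<longleftrightarrow> (\<exists>S \<subseteq> Lambda q. V = {x. \<forall>f\<in>S. f x = 0})"

(* The quotient of additive groups F/H, as the set of cosets of H in F. It is only meaningful for
   additive subgroups H \<subseteq> F; q-varieties are additive subgroups when q is a power of the
   characteristic. *)
definition add_quotient :: "('b::ab_group_add) set \<Rightarrow> 'b set \<Rightarrow> 'b set set" where
  "add_quotient F H = F // {(x, y). x \<in> F \<and> y \<in> F \<and> x - y \<in> H}"

definition irreducible_q_variety :: "nat \<Rightarrow> (('a::field) ^ 'n) set \<Rightarrow> bool" where
  "irreducible_q_variety q F \<longleftrightarrow>
     q_variety q F \<and>
     (\<forall>H. q_variety q H \<and> H \<subseteq> F \<and> finite (add_quotient F H) \<longrightarrow> H = F)"

definition q_chain :: "nat \<Rightarrow> (('a::field) ^ 'n) set \<Rightarrow> ('a ^ 'n) set list \<Rightarrow> bool" where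
  "q_chain q F Cs \<longleftrightarrow>
     Cs \<noteq> [] \<and> sorted_wrt (\<subset>) Cs \<and> (\<forall>C \<in> set Cs. irreducible_q_variety q C \<and> C \<subseteq> F)"

(* The chain F_0, ..., F_m has m + 1 members and length m. *)
definition chain_length :: "'b list \<Rightarrow> nat" where
  "chain_length Cs = length Cs - 1"

(* Maximality is with respect to refinement: no irreducible q-variety can be inserted anywhere. *)
definition maximal_q_chain :: "nat \<Rightarrow> (('a::field) ^ 'n) set \<Rightarrow> ('a ^ 'n) set list \<Rightarrow> bool" where
  "maximal_q_chain q F Cs \<longleftrightarrow>
     q_chain q F Cs \<and> \<not> (\<exists>Ds. q_chain q F Ds \<and> set Cs \<subset> set Ds)"

(* Max is meaningful: {0} is irreducible and contained in every q-variety, so chains exist, and their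
   lengths in K^n are at most n. *)
definition q_dim :: "nat \<Rightarrow> (('a::field) ^ 'n) set \<Rightarrow> nat" where
  "q_dim q F = Max {chain_length Cs | Cs. q_chain q F Cs}"

end

theory Submission
  imports Defs "HOL-Library.Product_Plus"
begin

text \<open>Let \<open>V\<^sub>k\<close> be the section of a \<open>q\<close>-variety \<open>V\<close> on which the first \<open>k\<close> coordinates vanish. Right
  division in \<open>K{\<tau>}\<close> eliminates coordinates, so the image of a \<open>q\<close>-variety under an element of
  \<open>\<Lambda>\<^sub>n\<close> is again cut out by additive polynomials, i.e. it is finite or all of \<open>K\<close>. The number \<open>dim V\<close>
  of indices \<open>k\<close> for which the next coordinate maps \<open>V\<^sub>k\<close> onto \<open>K\<close> is monotone, and for \<open>W \<subseteq> V\<close> one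
  has \<open>dim W = dim V\<close> iff \<open>V/W\<close> is finite. Hence \<open>dim\<close> increases strictly along chains of
  irreducible varieties. One additive equation lowers \<open>dim\<close> by at most one, and every \<open>V\<close> has an
  irreducible identity component of the same dimension containing all irreducible subvarieties, so
  a chain with a jump of two or more can be refined: maximal chains have length \<open>dim V\<close>.\<close>

section \<open>Additive polynomials\<close>

text \<open>Reading membership off the support turns closure under sums, differences and scalars
  into a statement about single coefficients.\<close>

lemma additive_polys_iff:
  assumes "q \<ge> 2"
  shows "P \<in> additive_polys q \<longleftrightarrow> (\<forall>m. coeff P m \<noteq> 0 \<longrightarrow> (\<exists>i. m = q ^ i))"
proof
  assume "P \<in> additive_polys q"
  then obtain d a where P: "P = (\<Sum>i\<le>d. monom (a i) (q ^ i))"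
    unfolding additive_polys_def by auto
  show "\<forall>m. coeff P m \<noteq> 0 \<longrightarrow> (\<exists>i. m = q ^ i)"
  proof (intro allI impI)
    fix m assume "coeff P m \<noteq> 0"
    then obtain i where "coeff (monom (a i) (q ^ i)) m \<noteq> 0"
      unfolding P coeff_sum by (metis (no_types, lifting) sum.neutral)
    then show "\<exists>i. m = q ^ i" by (auto split: if_splits)
  qed
next
  assume supp: "\<forall>m. coeff P m \<noteq> 0 \<longrightarrow> (\<exists>i. m = q ^ i)"
  \<comment> \<open>Since \<open>j < q ^ j\<close>, every exponent \<open>q ^ j\<close> in the
    support has its index \<open>j\<close> below the degree, so \<open>degree P\<close> can bound
    the summation.\<close>
  have "P = (\<Sum>i\<le>degree P. monom (coeff P (q ^ i)) (q ^ i))"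
  proof (rule poly_eqI)
    fix m
    have *: "coeff (\<Sum>i\<le>degree P. monom (coeff P (q ^ i)) (q ^ i)) m =
        (\<Sum>i\<le>degree P. if q ^ i = m then coeff P m else 0)"
      unfolding coeff_sum by (intro sum.cong) auto
    show "coeff P m = coeff (\<Sum>i\<le>degree P. monom (coeff P (q ^ i)) (q ^ i)) m"
    proof (cases "coeff P m = 0")
      case True
      then show ?thesis unfolding * by (simp add: sum.neutral)
    next
      case False
      then obtain j where j: "m = q ^ j" using supp by blast
      have "j < q ^ j" using assms by (intro power_gt_expt) auto
      moreover have "m \<le> degree P" using False by (rule le_degree)
      ultimately have "j \<in> {..degree P}" using j by simp
      moreover have "q ^ i = m \<longleftrightarrow> i = j" for i using j assms by auto
      ultimately show ?thesis unfolding * by simp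
    qed
  qed
  then show "P \<in> additive_polys q"
    unfolding additive_polys_def by (intro CollectI exI[of _ "degree P"] exI[of _ "\<lambda>i. coeff P (q ^ i)"]) auto
qed

text \<open>Over a finite field the product of all \<open>X - a\<close>, increased by 1, would have
  positive degree and no root.\<close>

lemma infinite_UNIV_alg_closed: "infinite (UNIV :: 'a::alg_closed_field set)"
proof
  assume fin: "finite (UNIV :: 'a set)"
  define P :: "'a poly" where "P = (\<Prod>a\<in>UNIV. [:- a, 1:])"
  have "degree P = card (UNIV :: 'a set)"
    unfolding P_def by (subst degree_prod_eq_sum_degree) auto
  then have deg: "degree (P + 1) > 0"
    using fin by (simp add: degree_add_eq_left card_gt_0_iff)
  obtain x where "poly (P + 1) x = 0" using alg_closed_imp_poly_has_root[OF deg] by blast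
  moreover have "poly P x = 0"
    unfolding P_def poly_prod using fin by (simp add: prod_zero_iff)
  ultimately show False by simp
qed

lemma poly_eqI_pointwise:
  fixes P Q :: "'a::alg_closed_field poly"
  assumes "\<And>x. poly P x = poly Q x"
  shows "P = Q"
proof (rule ccontr)
  assume "P \<noteq> Q"
  then have "finite {x. poly (P - Q) x = 0}" by (intro poly_roots_finite) simp
  then show False using assms infinite_UNIV_alg_closed[where ?'a = 'a] by simp
qed

section \<open>Arithmetic of the ring of additive polynomials\<close>

locale additive_setting =
  fixes q :: nat and K :: "'a::alg_closed_field itself"
  assumes prime_char: "prime CHAR('a)"
    and q_power: "\<exists>r\<ge>1. q = CHAR('a) ^ r"
begin

abbreviation R :: "'a poly set" where "R \<equiv> additive_polys q"

lemma q_ge_2: "q \<ge> 2"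
proof -
  obtain r where "r \<ge> 1" "q = CHAR('a) ^ r" using q_power by blast
  then show ?thesis using prime_ge_2_nat[OF prime_char]
    by (metis One_nat_def Suc_le_eq le_trans not_less_eq_eq numeral_2_eq_2 self_le_power zero_less_Suc)
qed

lemma R_iff: "P \<in> R \<longleftrightarrow> (\<forall>m. coeff P m \<noteq> 0 \<longrightarrow> (\<exists>i. m = q ^ i))"
  by (rule additive_polys_iff[OF q_ge_2])

lemma R_0: "0 \<in> R" and R_monom: "monom c (q ^ i) \<in> R"
  by (auto simp: R_iff)

lemma R_diff: "P \<in> R \<Longrightarrow> Q \<in> R \<Longrightarrow> P - Q \<in> R"
  by (auto simp: R_iff) (metis diff_self)

lemma R_add: "P \<in> R \<Longrightarrow> Q \<in> R \<Longrightarrow> P + Q \<in> R"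
  by (auto simp: R_iff) (metis add_0)

lemma R_smult: "P \<in> R \<Longrightarrow> smult c P \<in> R"
  by (auto simp: R_iff)

lemma R_sum: "(\<And>i. i \<in> I \<Longrightarrow> P i \<in> R) \<Longrightarrow> (\<Sum>i\<in>I. P i) \<in> R"
  by (induction I rule: infinite_finite_induct) (auto simp: R_0 R_add)

lemma q_power_char: "\<exists>r. q ^ i = CHAR('a) ^ r"
  using q_power by (metis power_mult)

text \<open>The ring \<open>'a poly\<close> inherits the characteristic of \<open>'a\<close>, so the
  Frobenius identity holds for polynomials themselves. This gives closure of \<open>R\<close> under
  composition.\<close>

lemma frobenius_poly_sum: "(\<Sum>i\<in>I. (f i :: 'a poly)) ^ q ^ j = (\<Sum>i\<in>I. f i ^ q ^ j)"
  using q_power_char[of j] freshmans_dream_sum'[where ?'a = "'a poly"] prime_char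
  by (metis semiring_char_poly)

lemma frobenius_diff: "((x::'a) - y) ^ q ^ j = x ^ q ^ j - y ^ q ^ j"
  \<comment> \<open>The rule for sums is applied to \<open>(x - y) + y\<close>.\<close>
  using q_power_char[of j] freshmans_dream'[OF prime_char, of "q ^ j" _ "x - y" y]
  by (auto simp: algebra_simps)

lemma poly_R_diff:
  assumes "P \<in> R"
  shows "poly P (x - y) = poly P x - poly P y"
proof -
  obtain d a where P: "P = (\<Sum>i\<le>d. monom (a i) (q ^ i))"
    using assms unfolding additive_polys_def by auto
  show ?thesis
    by (simp add: P poly_sum poly_monom frobenius_diff algebra_simps sum_subtractf)
qed

lemma poly_R_0: "P \<in> R \<Longrightarrow> poly P 0 = 0"
  using poly_R_diff[of P 0 0] by simp

lemma poly_R_add: "P \<in> R \<Longrightarrow> poly P (x + y) = poly P x + poly P y"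
  using poly_R_diff[of P "x + y" y] by simp

lemma poly_R_sum: "P \<in> R \<Longrightarrow> poly P (\<Sum>i\<in>I. f i) = (\<Sum>i\<in>I. poly P (f i))"
  by (induction I rule: infinite_finite_induct) (auto simp: poly_R_0 poly_R_add)

lemma R_power: "P \<in> R \<Longrightarrow> P ^ q ^ j \<in> R"
proof -
  assume "P \<in> R"
  then obtain d a where P: "P = (\<Sum>i\<le>d. monom (a i) (q ^ i))"
    unfolding additive_polys_def by auto
  show ?thesis
    unfolding P frobenius_poly_sum
    by (intro R_sum) (simp add: monom_power power_add[symmetric] R_monom)
qed

lemma pcompose_monom_eq: "pcompose (monom c j) B = smult c (B ^ j)" for B :: "'a poly"
  by (induction j) (auto simp: monom_0 monom_Suc pcompose_pCons mult.commute)

lemma R_pcompose: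
  assumes "P \<in> R" "Q \<in> R"
  shows "pcompose P Q \<in> R"
proof -
  obtain d a where P: "P = (\<Sum>i\<le>d. monom (a i) (q ^ i))"
    using assms unfolding additive_polys_def by auto
  show ?thesis
    unfolding P pcompose_sum pcompose_monom_eq
    by (intro R_sum R_smult R_power assms)
qed

lemma degree_R:
  assumes "P \<in> R" "P \<noteq> 0"
  shows "\<exists>k. degree P = q ^ k"
  using assms R_iff leading_coeff_0_iff by blast

lemma degree_R_pos: "P \<in> R \<Longrightarrow> P \<noteq> 0 \<Longrightarrow> degree P > 0"
  using degree_R q_ge_2 by (metis gr0I not_numeral_le_zero power_not_zero)

text \<open>The degree of a nonzero element of \<open>R\<close> is a power of \<open>q\<close>,
  hence positive, so subtracting a constant leaves a polynomial with a root.\<close>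

lemma R_surj:
  assumes "P \<in> R" "P \<noteq> 0"
  shows "\<exists>s. poly P s = y"
proof -
  have "degree (P + [:- y:]) > 0"
    using degree_R_pos[OF assms] by (simp add: degree_add_eq_left)
  then obtain s where "poly (P + [:- y:]) s = 0" using alg_closed_imp_poly_has_root by blast
  then show ?thesis by (intro exI[of _ s]) simp
qed

text \<open>All degrees are powers of \<open>q\<close>, so a larger degree is a multiple of a
  smaller one by some \<open>q ^ (m - k)\<close>, and a monomial of \<open>R\<close> composed with
  \<open>B\<close> cancels the leading term of \<open>A\<close>.\<close>

lemma R_division:
  assumes "A \<in> R" "B \<in> R" "B \<noteq> 0"
  shows "\<exists>Q\<in>R. A - pcompose Q B = 0 \<or> degree (A - pcompose Q B) < degree B"
  using assms(1)
proof (induction "degree A" arbitrary: A rule: less_induct)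
  case less
  show ?case
  proof (cases "A = 0 \<or> degree A < degree B")
    case True
    then show ?thesis using R_0 by (intro bexI[of _ 0]) auto
  next
    case False
    obtain m k where m: "degree A = q ^ m" and k: "degree B = q ^ k"
      using degree_R less.prems assms False by meson
    have "q ^ k \<le> q ^ m" using False m k by simp
    then have "k \<le> m" using q_ge_2 power_le_imp_le_exp[of q k m] by simp
    define j where "j = q ^ (m - k)"
    \<comment> \<open>Composing the monomial with \<open>B\<close> raises the leading coefficient of
      \<open>B\<close> to the power \<open>j\<close>; dividing by that power makes the leading terms
      agree.\<close>
    define c where "c = lead_coeff A / lead_coeff B ^ j"
    define M where "M = monom c j"
    have M: "M \<in> R" unfolding M_def j_def by (rule R_monom)
    have MB: "pcompose M B = smult c (B ^ j)" unfolding M_def by (rule pcompose_monom_eq)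
    have c: "c \<noteq> 0" unfolding c_def using False assms by auto
    have deg: "degree (pcompose M B) = degree A"
      unfolding MB using c by (simp add: degree_power_eq assms m k j_def \<open>k \<le> m\<close> flip: power_add)
    have lc: "lead_coeff (pcompose M B) = lead_coeff A"
      unfolding MB using assms(3) by (simp add: lead_coeff_power c_def)
    define A' where "A' = A - pcompose M B"
    have A': "A' \<in> R" unfolding A'_def using less.prems M assms by (intro R_diff R_pcompose)
    have pos: "degree A > 0" using degree_R_pos less.prems False by blast
    have "degree A' < degree A"
    proof -
      have "degree A' \<le> degree A" unfolding A'_def using deg by (intro degree_diff_le) auto
      moreover have "coeff A' (degree A) = 0" unfolding A'_def using lc deg by simp
      ultimately show ?thesis using pos
        by (metis degree_0 eq_zero_or_degree_less le_degree leading_coeff_0_iff order_le_less)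
    qed
    from less.hyps[OF this A'] obtain Q where Q: "Q \<in> R"
      "A' - pcompose Q B = 0 \<or> degree (A' - pcompose Q B) < degree B" by blast
    have "A - pcompose (M + Q) B = A' - pcompose Q B"
      unfolding A'_def by (simp add: pcompose_add)
    then show ?thesis using Q M R_add by (metis (no_types))
  qed
qed

section \<open>Elimination of coordinates\<close>

text \<open>For nonempty \<open>N\<close>, closure under this one operation amounts to being a left
  \<open>R\<close>-module under composition. It is also the form in which remainders of right
  division appear.\<close>

definition left_submodule :: "('x \<Rightarrow> 'a) set \<Rightarrow> bool" where
  "left_submodule N \<longleftrightarrow> (\<forall>Q\<in>R. \<forall>f\<in>N. \<forall>g\<in>N. (\<lambda>x. f x - poly Q (g x)) \<in> N)"

text \<open>Each \<open>h\<close> varies along \<open>e\<close> by a polynomial \<open>D h\<close>.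
  Some \<open>g\<close> with \<open>D g\<close> nonzero of least degree can be solved for
  \<open>s\<close>. Division by \<open>D g\<close> reduces any other \<open>h\<close> to a remainder
  that is constant along \<open>e\<close>, and such equations hold at \<open>x\<close> by
  assumption.\<close>

lemma eliminate_coordinate:
  fixes N :: "('x::ab_group_add \<Rightarrow> 'a) set" and e :: "'a \<Rightarrow> 'x"
  assumes N: "left_submodule N"
    and e: "\<And>h. h \<in> N \<Longrightarrow> \<exists>P\<in>R. \<forall>x s. h (x + e s) = h x + poly P s"
  shows "(\<exists>s. \<forall>h\<in>N. h (x + e s) = 0) \<longleftrightarrow>
    (\<forall>h\<in>N. (\<forall>y s. h (y + e s) = h y) \<longrightarrow> h x = 0)"
proof
  assume "\<exists>s. \<forall>h\<in>N. h (x + e s) = 0"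
  then show "\<forall>h\<in>N. (\<forall>y s. h (y + e s) = h y) \<longrightarrow> h x = 0" by metis
next
  assume inv: "\<forall>h\<in>N. (\<forall>y s. h (y + e s) = h y) \<longrightarrow> h x = 0"
  obtain D where D: "\<And>h. h \<in> N \<Longrightarrow> D h \<in> R"
    "\<And>h x s. h \<in> N \<Longrightarrow> h (x + e s) = h x + poly (D h) s"
    using e by metis
  show "\<exists>s. \<forall>h\<in>N. h (x + e s) = 0"
  proof (cases "\<forall>h\<in>N. D h = 0")
    case True
    then have "h (y + e s) = h y" if "h \<in> N" for h y s using D(2)[OF that] that by simp
    then have "\<forall>h\<in>N. h (x + e 0) = 0" using inv by metis
    then show ?thesis by blast
  next
    case False
    then obtain g where g: "g \<in> N" "D g \<noteq> 0"
      and min: "\<And>h. h \<in> N \<Longrightarrow> D h \<noteq> 0 \<Longrightarrow> degree (D g) \<le> degree (D h)"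
      using ex_has_least_nat[of "\<lambda>h. h \<in> N \<and> D h \<noteq> 0" _ "\<lambda>h. degree (D h)"] by blast
    obtain s where s: "poly (D g) s = - g x" using R_surj[OF D(1)] g by blast
    have gs: "g (x + e s) = 0" using D(2)[OF g(1)] s by simp
    have "h (x + e s) = 0" if h: "h \<in> N" for h
    proof -
      obtain Q where Q: "Q \<in> R"
        "D h - pcompose Q (D g) = 0 \<or> degree (D h - pcompose Q (D g)) < degree (D g)"
        using R_division D(1) h g by blast
      define r where "r = (\<lambda>y. h y - poly Q (g y))"
      have r: "r \<in> N" unfolding r_def using N h g Q by (auto simp: left_submodule_def)
      have step: "r (y + e t) = r y + poly (D h - pcompose Q (D g)) t" for y t
        unfolding r_def using D(2)[OF h] D(2)[OF g(1)] Q(1) by (simp add: poly_R_add poly_pcompose)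
      \<comment> \<open>\<open>D r\<close> comes from a choice, but its values determine it because
        the field is infinite.\<close>
      have "poly (D r) t = poly (D h - pcompose Q (D g)) t" for t
        using step[of 0 t] D(2)[OF r, of 0 t] by simp
      then have "D r = D h - pcompose Q (D g)"
        by (rule poly_eqI_pointwise)
      then have "D r = 0" using Q(2) min[OF r] by force
      then have "r (y + e t) = r y" for y t using D(2)[OF r] by simp
      then have "r (x + e s) = 0" using inv r by simp
      then show ?thesis unfolding r_def using gs Q(1) by (simp add: poly_R_0)
    qed
    then show ?thesis by blast
  qed
qed

text \<open>The equations constant along one direction again form a left submodule, so the
  directions can be removed one at a time.\<close>

lemma eliminate_coordinates:
  fixes N :: "('x::ab_group_add \<Rightarrow> 'a) set" and e :: "'i \<Rightarrow> 'a \<Rightarrow> 'x"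
  assumes "finite I" "left_submodule N"
    and "\<And>h i. h \<in> N \<Longrightarrow> i \<in> I \<Longrightarrow> \<exists>P\<in>R. \<forall>x s. h (x + e i s) = h x + poly P s"
  shows "(\<exists>s. \<forall>h\<in>N. h (x + (\<Sum>i\<in>I. e i (s i))) = 0) \<longleftrightarrow>
    (\<forall>h\<in>N. (\<forall>i\<in>I. \<forall>y s. h (y + e i s) = h y) \<longrightarrow> h x = 0)"
  using assms
proof (induction I arbitrary: N rule: finite_induct)
  case empty
  then show ?case by simp
next
  case (insert i I)
  define N' where "N' = {h \<in> N. \<forall>y s. h (y + e i s) = h y}"
  have N': "left_submodule N'"
    using insert.prems(1) unfolding N'_def left_submodule_def by simp
  \<comment> \<open>As \<open>i\<close> lies outside \<open>I\<close>, the parameter for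
    \<open>i\<close> can be set afterwards without disturbing the others.\<close>
  have upd: "(\<Sum>j\<in>I. e j ((s(i := t)) j)) = (\<Sum>j\<in>I. e j (s j))" for s t
    using insert.hyps(2) by (intro sum.cong) auto
  have "(\<exists>s. \<forall>h\<in>N. h (x + (\<Sum>j\<in>insert i I. e j (s j))) = 0) \<longleftrightarrow>
      (\<exists>s t. \<forall>h\<in>N. h ((x + (\<Sum>j\<in>I. e j (s j))) + e i t) = 0)"
  proof
    assume "\<exists>s. \<forall>h\<in>N. h (x + (\<Sum>j\<in>insert i I. e j (s j))) = 0"
    then show "\<exists>s t. \<forall>h\<in>N. h ((x + (\<Sum>j\<in>I. e j (s j))) + e i t) = 0"
      using insert.hyps by (auto simp: algebra_simps)
  next
    assume "\<exists>s t. \<forall>h\<in>N. h ((x + (\<Sum>j\<in>I. e j (s j))) + e i t) = 0"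
    then obtain s t where "\<forall>h\<in>N. h ((x + (\<Sum>j\<in>I. e j (s j))) + e i t) = 0" by blast
    then have "\<forall>h\<in>N. h (x + (\<Sum>j\<in>insert i I. e j ((s(i := t)) j))) = 0"
      using insert.hyps upd by (simp add: algebra_simps)
    then show "\<exists>s. \<forall>h\<in>N. h (x + (\<Sum>j\<in>insert i I. e j (s j))) = 0" by blast
  qed
  also have "\<dots> \<longleftrightarrow> (\<exists>s. \<forall>h\<in>N'. h (x + (\<Sum>j\<in>I. e j (s j))) = 0)"
    unfolding N'_def
    using eliminate_coordinate[OF insert.prems(1), of "e i"] insert.prems(2) by auto
  also have "\<dots> \<longleftrightarrow> (\<forall>h\<in>N'. (\<forall>j\<in>I. \<forall>y s. h (y + e j s) = h y) \<longrightarrow> h x = 0)"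
    using insert.prems(2) by (intro insert.IH N') (auto simp: N'_def)
  finally show ?case unfolding N'_def by auto
qed

section \<open>The additive functions in \<open>Lambda q\<close>\<close>

lemma LambdaE:
  fixes f :: "'a ^ 'n \<Rightarrow> 'a"
  assumes "f \<in> Lambda q"
  obtains P where "f = (\<lambda>x. \<Sum>i\<in>UNIV. poly (P i) (x $ i))" "\<And>i. P i \<in> R"
  using assms unfolding Lambda_def by blast

lemma LambdaI: "(\<And>i. P i \<in> R) \<Longrightarrow> (\<lambda>x. \<Sum>i\<in>UNIV. poly (P i) (x $ i)) \<in> Lambda q"
  unfolding Lambda_def by blast

lemma Lambda_diff:
  assumes "f \<in> Lambda q"
  shows "f (x - y) = (f x - f y :: 'a)"
  using assms by (elim LambdaE) (simp add: poly_R_diff sum_subtractf)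

lemma Lambda_at_0: "f \<in> Lambda q \<Longrightarrow> f 0 = (0::'a)"
  using Lambda_diff[of f 0 0] by simp

text \<open>Additivity of \<open>Q\<close> moves it inside the sum over the coordinates, where it
  composes with each \<open>P' i\<close>.\<close>

lemma Lambda_minus_compose:
  fixes f g :: "'a ^ 'n \<Rightarrow> 'a"
  assumes "f \<in> Lambda q" "g \<in> Lambda q" "Q \<in> R"
  shows "(\<lambda>x. f x - poly Q (g x)) \<in> Lambda q"
proof -
  obtain P where P: "f = (\<lambda>x. \<Sum>i\<in>UNIV. poly (P i) (x $ i))" "\<And>i. P i \<in> R"
    using LambdaE[OF assms(1)] by blast
  obtain P' where P': "g = (\<lambda>x. \<Sum>i\<in>UNIV. poly (P' i) (x $ i))" "\<And>i. P' i \<in> R"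
    using LambdaE[OF assms(2)] by blast
  have "(\<lambda>x. f x - poly Q (g x)) =
      (\<lambda>x. \<Sum>i\<in>UNIV. poly (P i - pcompose Q (P' i)) (x $ i))"
    using P P' assms(3) by (simp add: poly_R_sum sum_subtractf poly_pcompose)
  moreover have "P i - pcompose Q (P' i) \<in> R" for i
    using P P' assms(3) by (intro R_diff R_pcompose)
  ultimately show ?thesis using LambdaI[of "\<lambda>i. P i - pcompose Q (P' i)"] by (simp only:)
qed

lemma Lambda_coordinate: "(\<lambda>x. x $ i) \<in> (Lambda q :: ('a ^ 'n \<Rightarrow> 'a) set)"
proof -
  \<comment> \<open>The exponent \<open>q ^ 0\<close> yields the polynomial
    \<open>X\<close>.\<close>
  have "(\<lambda>x. \<Sum>j\<in>UNIV. poly (if j = i then monom 1 (q ^ 0) else 0) (x $ j)) \<in>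
      (Lambda q :: ('a ^ 'n \<Rightarrow> 'a) set)"
    using R_monom[of 1 0] R_0 by (intro LambdaI) auto
  moreover have "poly (if j = i then monom 1 (q ^ 0) else 0) (x $ j) =
      (if j = i then x $ j else 0)" for x :: "'a ^ 'n" and j
    by (simp add: poly_monom)
  ultimately show ?thesis by simp
qed

lemma Lambda_axis:
  fixes f :: "'a ^ 'n \<Rightarrow> 'a"
  assumes "f \<in> Lambda q"
  shows "\<exists>P\<in>R. \<forall>x s. f (x + axis i s) = f x + poly P s"
proof -
  obtain P where P: "f = (\<lambda>x. \<Sum>i\<in>UNIV. poly (P i) (x $ i))" "\<And>i. P i \<in> R"
    using LambdaE[OF assms] by blast
  have "poly (P j) ((x + axis i s) $ j) = poly (P j) (x $ j) + (if j = i then poly (P i) s else 0)"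
    for x :: "'a ^ 'n" and s j
    using P(2) by (simp add: poly_R_add poly_R_0 axis_def)
  then have "f (x + axis i s) = f x + poly (P i) s" for x s
    unfolding P(1) by (simp add: sum.distrib)
  then show ?thesis using P(2) by blast
qed

lemma sum_axis: "(\<Sum>i\<in>UNIV. axis i (x $ i)) = (x :: 'a ^ 'n)"
  by (simp add: vec_eq_iff axis_def)

text \<open>The coordinates of \<open>K\<^sup>n\<close> are eliminated from the equations of the graph of \<open>f\<close> on \<open>V\<close>,
  which leaves additive equations in one variable.\<close>

lemma q_variety_image:
  fixes V :: "('a ^ 'n) set"
  assumes V: "q_variety q V" and f: "f \<in> Lambda q"
  shows "finite (f ` V) \<or> f ` V = UNIV"
proof -
  obtain S where S: "S \<subseteq> Lambda q" "V = {x. \<forall>g\<in>S. g x = 0}"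
    using V unfolding q_variety_def by blast
  \<comment> \<open>\<open>N\<close> consists of all additive equations in the pair
    \<open>(x, t)\<close> that hold on the graph of \<open>f\<close> over \<open>V\<close>.\<close>
  define N where "N = {h. (\<exists>g\<in>Lambda q. \<exists>P\<in>R. h = (\<lambda>z :: ('a ^ 'n) \<times> 'a. g (fst z) + poly P (snd z))) \<and>
    (\<forall>x\<in>V. h (x, f x) = 0)}"
  define e where "e = (\<lambda>(i::'n) (s::'a). (axis i s :: 'a ^ 'n, 0 :: 'a))"
  have mod: "left_submodule N"
    unfolding left_submodule_def
  proof (intro ballI)
    fix Q h k assume Q: "Q \<in> R" and h: "h \<in> N" and k: "k \<in> N"
    obtain g P where g: "g \<in> Lambda q" "P \<in> R" "h = (\<lambda>z. g (fst z) + poly P (snd z))"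
      using h unfolding N_def by blast
    obtain g' P' where g': "g' \<in> Lambda q" "P' \<in> R" "k = (\<lambda>z. g' (fst z) + poly P' (snd z))"
      using k unfolding N_def by blast
    have "(\<lambda>z. h z - poly Q (k z)) =
        (\<lambda>z. (g (fst z) - poly Q (g' (fst z))) + poly (P - pcompose Q P') (snd z))"
      using g(3) g'(3) Q by (simp add: poly_R_add poly_pcompose algebra_simps)
    moreover have "(\<lambda>x. g x - poly Q (g' x)) \<in> Lambda q" "P - pcompose Q P' \<in> R"
      using g g' Q by (intro Lambda_minus_compose R_diff R_pcompose; simp)+
    moreover have "h (x, f x) - poly Q (k (x, f x)) = 0" if "x \<in> V" for x
      using that h k Q unfolding N_def by (simp add: poly_R_0)
    ultimately show "(\<lambda>z. h z - poly Q (k z)) \<in> N"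
      unfolding N_def
      by (intro CollectI conjI bexI[of _ "\<lambda>x. g x - poly Q (g' x)"] bexI[of _ "P - pcompose Q P'"] ballI)
  qed
  have step: "\<exists>P\<in>R. \<forall>z s. h (z + e i s) = h z + poly P s" if h: "h \<in> N" for h i
  proof -
    obtain g P where g: "g \<in> Lambda q" "P \<in> R" "h = (\<lambda>z. g (fst z) + poly P (snd z))"
      using h unfolding N_def by blast
    obtain P' where "P' \<in> R" "\<forall>x s. g (x + axis i s) = g x + poly P' s"
      using Lambda_axis[OF g(1)] by blast
    then show ?thesis using g(3) unfolding e_def by (intro bexI[of _ P']) auto
  qed
  \<comment> \<open>\<open>N\<close> contains the equations of \<open>V\<close> and the equation
    \<open>f x - t = 0\<close>, so its common zeros are exactly the graph.\<close>
  have graph: "(\<forall>h\<in>N. h (x, t) = 0) \<longleftrightarrow> x \<in> V \<and> t = f x" for x t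
  proof
    assume z: "\<forall>h\<in>N. h (x, t) = 0"
    have "(\<lambda>z. g (fst z) + poly 0 (snd z)) \<in> N" if "g \<in> S" for g
      using that S R_0 unfolding N_def
      by (intro CollectI conjI bexI[of _ g] bexI[of _ 0]) auto
    then have "x \<in> V" unfolding S(2) using z by force
    moreover have "(\<lambda>z. f (fst z) + poly (monom (- 1) (q ^ 0)) (snd z)) \<in> N"
      using f R_monom[of "- 1" 0] unfolding N_def
      by (intro CollectI conjI bexI[of _ f] bexI[of _ "monom (- 1) (q ^ 0)"]) (auto simp: poly_monom)
    then have "f x + poly (monom (- 1) (q ^ 0)) t = 0" using z by fastforce
    then have "t = f x" by (simp add: poly_monom)
    ultimately show "x \<in> V \<and> t = f x" by simp
  next
    assume "x \<in> V \<and> t = f x"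
    then show "\<forall>h\<in>N. h (x, t) = 0" unfolding N_def by auto
  qed
  have sum_e: "(0, t) + (\<Sum>i\<in>UNIV. e i (s i)) = (\<Sum>i\<in>UNIV. axis i (s i), t)" for t s
    unfolding e_def by (simp add: prod_eq_iff fst_sum snd_sum)
  \<comment> \<open>Projecting the graph to \<open>t\<close> starts from the base point
    \<open>(0, t)\<close>, from which sums of axis vectors reach every
    \<open>(x, t)\<close>.\<close>
  have img: "t \<in> f ` V \<longleftrightarrow>
      (\<forall>h\<in>N. (\<forall>i. \<forall>z s. h (z + e i s) = h z) \<longrightarrow> h (0, t) = 0)" for t
  proof -
    have "t \<in> f ` V \<longleftrightarrow> (\<exists>x. \<forall>h\<in>N. h (x, t) = 0)"
      unfolding graph by blast
    also have "\<dots> \<longleftrightarrow> (\<exists>s. \<forall>h\<in>N. h ((0, t) + (\<Sum>i\<in>UNIV. e i (s i))) = 0)"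
      unfolding sum_e
    proof
      assume "\<exists>x. \<forall>h\<in>N. h (x, t) = 0"
      then obtain x where "\<forall>h\<in>N. h (x, t) = 0" by blast
      then have "\<forall>h\<in>N. h (\<Sum>i\<in>UNIV. axis i (x $ i), t) = 0" by (simp add: sum_axis)
      then show "\<exists>s. \<forall>h\<in>N. h (\<Sum>i\<in>UNIV. axis i (s i), t) = 0" by blast
    qed blast
    also have "\<dots> \<longleftrightarrow> (\<forall>h\<in>N. (\<forall>i\<in>UNIV. \<forall>z s. h (z + e i s) = h z) \<longrightarrow> h (0, t) = 0)"
      using step by (intro eliminate_coordinates mod) auto
    finally show ?thesis by simp
  qed
  have one_var: "\<exists>P\<in>R. \<forall>t. h (0, t) = poly P t" if h: "h \<in> N" for h
  proof -
    obtain g P where "g \<in> Lambda q" "P \<in> R" "h = (\<lambda>z. g (fst z) + poly P (snd z))"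
      using h unfolding N_def by blast
    then show ?thesis using Lambda_at_0 by (intro bexI[of _ P]) auto
  qed
  show ?thesis
  proof (cases "f ` V = UNIV")
    case False
    \<comment> \<open>A value missed by \<open>f\<close> violates some equation in \<open>t\<close>
      alone; its polynomial is nonzero and has finitely many roots.\<close>
    then obtain t h where h: "h \<in> N" "\<forall>i. \<forall>z s. h (z + e i s) = h z" "h (0, t) \<noteq> 0"
      unfolding img[abs_def] set_eq_iff by blast
    obtain P where P: "P \<in> R" "\<forall>t. h (0, t) = poly P t" using one_var[OF h(1)] by blast
    have "P \<noteq> 0" using P(2) h(3) by (metis poly_0)
    moreover have "f ` V \<subseteq> {t. poly P t = 0}"
    proof
      fix t assume "t \<in> f ` V"
      then have "h (0, t) = 0" using h(1,2) unfolding img by blast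
      then show "t \<in> {t. poly P t = 0}" using P(2) by simp
    qed
    ultimately show ?thesis using poly_roots_finite finite_subset by blast
  qed simp
qed

end

section \<open>Finite index\<close>

definition add_subgroup :: "'x::ab_group_add set \<Rightarrow> bool" where
  "add_subgroup G \<longleftrightarrow> 0 \<in> G \<and> (\<forall>x\<in>G. \<forall>y\<in>G. x - y \<in> G)"

definition finite_index :: "'x::ab_group_add set \<Rightarrow> 'x set \<Rightarrow> bool" where
  "finite_index G H \<longleftrightarrow> (\<exists>T. finite T \<and> T \<subseteq> G \<and> (\<forall>x\<in>G. \<exists>t\<in>T. x - t \<in> H))"

lemma add_subgroup_0: "add_subgroup G \<Longrightarrow> 0 \<in> G"
  and add_subgroup_diff: "add_subgroup G \<Longrightarrow> x \<in> G \<Longrightarrow> y \<in> G \<Longrightarrow> x - y \<in> G"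
  by (auto simp: add_subgroup_def)

lemma add_subgroup_minus: "add_subgroup G \<Longrightarrow> x \<in> G \<Longrightarrow> - x \<in> G"
  using add_subgroup_diff[of G 0 x] add_subgroup_0 by auto

lemma add_subgroup_add: "add_subgroup G \<Longrightarrow> x \<in> G \<Longrightarrow> y \<in> G \<Longrightarrow> x + y \<in> G"
  using add_subgroup_diff[of G x "- y"] add_subgroup_minus by auto

lemma finite_index_refl: "add_subgroup G \<Longrightarrow> finite_index G G"
  unfolding finite_index_def by (intro exI[of _ "{0}"]) (auto simp: add_subgroup_0)

lemma finite_imp_finite_index: "finite G \<Longrightarrow> add_subgroup H \<Longrightarrow> finite_index G H"
  unfolding finite_index_def by (intro exI[of _ G]) (auto intro!: bexI simp: add_subgroup_0)

text \<open>One representative per coset passes between the quotient set and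
  \<open>finite_index\<close>, the form used from here on.\<close>

lemma finite_add_quotient_iff:
  assumes "add_subgroup H" "H \<subseteq> G"
  shows "finite (add_quotient G H) \<longleftrightarrow> finite_index G H"
proof -
  define r where "r = {(x, y). x \<in> G \<and> y \<in> G \<and> x - y \<in> H}"
  have Q: "add_quotient G H = (\<lambda>x. r `` {x}) ` G"
    unfolding add_quotient_def r_def[symmetric] quotient_def by blast
  have r_eq: "r `` {x} = r `` {y}" if "x \<in> G" "y \<in> G" "x - y \<in> H" for x y
  proof -
    have "x - z \<in> H \<longleftrightarrow> y - z \<in> H" for z
      using add_subgroup_diff[OF assms(1) _ that(3), of "x - z"]
        add_subgroup_add[OF assms(1) that(3), of "y - z"] by auto
    then show ?thesis unfolding r_def using that by auto
  qed
  show ?thesis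
  proof
    assume "finite (add_quotient G H)"
    then obtain T where T: "finite T" "T \<subseteq> G" "add_quotient G H = (\<lambda>x. r `` {x}) ` T"
      unfolding Q using finite_subset_image[OF _ order_refl] by metis
    have "\<exists>t\<in>T. x - t \<in> H" if x: "x \<in> G" for x
    proof -
      have "r `` {x} \<in> (\<lambda>x. r `` {x}) ` T" using x unfolding T(3)[symmetric] Q by (rule imageI)
      then obtain t where t: "t \<in> T" "r `` {x} = r `` {t}" by (elim imageE)
      have "t \<in> r `` {t}" using t T(2) assms(1) unfolding r_def by (auto intro: add_subgroup_0)
      then have "(x, t) \<in> r" unfolding t(2)[symmetric] by simp
      then have "x - t \<in> H" unfolding r_def by simp
      then show ?thesis using t(1) by (rule bexI)
    qed
    then show "finite_index G H" unfolding finite_index_def using T by blast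
  next
    assume "finite_index G H"
    then obtain T where T: "finite T" "T \<subseteq> G" "\<And>x. x \<in> G \<Longrightarrow> \<exists>t\<in>T. x - t \<in> H"
      unfolding finite_index_def by blast
    have "add_quotient G H \<subseteq> (\<lambda>x. r `` {x}) ` T"
    proof
      fix X assume "X \<in> add_quotient G H"
      then obtain x where x: "x \<in> G" "X = r `` {x}" unfolding Q by blast
      then obtain t where "t \<in> T" "x - t \<in> H" using T(3) by blast
      then show "X \<in> (\<lambda>x. r `` {x}) ` T" using x r_eq[of x t] T(2) by auto
    qed
    then show "finite (add_quotient G H)" using T(1) finite_subset by blast
  qed
qed

lemma finite_index_Int:
  assumes "finite_index G H" "C \<subseteq> G" "add_subgroup H" "add_subgroup C"
  shows "finite_index C (C \<inter> H)"
proof -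
  obtain T where T: "finite T" "\<And>x. x \<in> G \<Longrightarrow> \<exists>t\<in>T. x - t \<in> H"
    using assms(1) unfolding finite_index_def by blast
  \<comment> \<open>A representative \<open>t\<close> may lie outside \<open>C\<close>;
    \<open>c t\<close> replaces it by an element of \<open>C\<close> in the same coset of
    \<open>H\<close>, whenever there is one.\<close>
  define c where "c t = (SOME c. c \<in> C \<and> c - t \<in> H)" for t
  define T' where "T' = c ` {t \<in> T. \<exists>c. c \<in> C \<and> c - t \<in> H}"
  have c: "c t \<in> C \<and> c t - t \<in> H" if "\<exists>c. c \<in> C \<and> c - t \<in> H" for t
    unfolding c_def using that by (rule someI_ex)
  have "\<exists>s\<in>T'. x - s \<in> C \<inter> H" if x: "x \<in> C" for x
  proof -
    obtain t where t: "t \<in> T" "x - t \<in> H" using T(2) x assms(2) by blast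
    have ct: "c t \<in> C" "c t - t \<in> H" using c x t by blast+
    have "x - c t \<in> H"
      using add_subgroup_diff[OF assms(3) t(2) ct(2)] by simp
    then show ?thesis using add_subgroup_diff[OF assms(4) x ct(1)] t x unfolding T'_def by blast
  qed
  moreover have "finite T'" "T' \<subseteq> C" unfolding T'_def using T(1) c by auto
  ultimately show ?thesis unfolding finite_index_def by blast
qed

text \<open>The nonempty fibres of \<open>f\<close> on \<open>G\<close> are cosets of the kernel,
  one for each value.\<close>

lemma finite_index_kernel:
  assumes "add_subgroup G" "\<And>x y. f (x - y) = f x - (f y :: 'b::ab_group_add)" "finite (f ` G)"
  shows "finite_index G (G \<inter> {x. f x = 0})"
proof -
  obtain T where T: "T \<subseteq> G" "finite T" "f ` G = f ` T"
    using finite_subset_image[OF assms(3) order_refl] by blast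
  have "\<exists>t\<in>T. x - t \<in> G \<inter> {x. f x = 0}" if "x \<in> G" for x
  proof -
    obtain t where "t \<in> T" "f x = f t" using T(3) \<open>x \<in> G\<close> by blast
    then show ?thesis using add_subgroup_diff[OF assms(1) \<open>x \<in> G\<close>] T(1) assms(2) by auto
  qed
  then show ?thesis unfolding finite_index_def using T by blast
qed

text \<open>Finitely many translates of \<open>H\<close> cover \<open>G\<close>, so finitely many
  translates of \<open>f\<close> H\<open>cover\<close>f \<open>G\<close>.\<close>

lemma finite_index_infinite_image:
  assumes "finite_index G H" "\<And>x y. f (x - y) = f x - (f y :: 'b::ab_group_add)" "infinite (f ` G)"
  shows "infinite (f ` H)"
proof
  assume fin: "finite (f ` H)"
  obtain T where T: "finite T" "\<And>x. x \<in> G \<Longrightarrow> \<exists>t\<in>T. x - t \<in> H"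
    using assms(1) unfolding finite_index_def by blast
  have "f ` G \<subseteq> (\<Union>t\<in>T. (\<lambda>b. b + f t) ` f ` H)"
  proof
    fix y assume "y \<in> f ` G"
    then obtain x t where x: "y = f x" "t \<in> T" "x - t \<in> H" using T(2) by blast
    have "y = f (x - t) + f t" using x(1) assms(2) by simp
    then show "y \<in> (\<Union>t\<in>T. (\<lambda>b. b + f t) ` f ` H)" using x by blast
  qed
  moreover have "finite (\<Union>t\<in>T. (\<lambda>b. b + f t) ` f ` H)" using T(1) fin by blast
  ultimately show False using assms(3) finite_subset by blast
qed

text \<open>An element of \<open>G\<close> is corrected first by a representative for its image and
  an element of \<open>H\<close>, which moves it into the kernel, and then by a representative
  there.\<close>

lemma finite_index_extension:
  assumes H: "add_subgroup H" "H \<subseteq> G" and G: "add_subgroup G"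
    and f: "\<And>x y. f (x - y) = f x - (f y :: 'b::ab_group_add)"
    and img: "finite_index (f ` G) (f ` H)"
    and ker: "finite_index (G \<inter> {x. f x = 0}) (H \<inter> {x. f x = 0})"
  shows "finite_index G H"
proof -
  obtain T where T: "finite T" "T \<subseteq> f ` G" "\<forall>y\<in>f ` G. \<exists>t\<in>T. y - t \<in> f ` H"
    using img unfolding finite_index_def by (elim exE conjE)
  obtain S where S: "S \<subseteq> G" "finite S" "T = f ` S"
    using finite_subset_image[OF T(1,2)] by (elim exE conjE bexE) metis
  obtain U where U: "finite U" "U \<subseteq> G \<inter> {x. f x = 0}"
    "\<forall>x\<in>G \<inter> {x. f x = 0}. \<exists>u\<in>U. x - u \<in> H \<inter> {x. f x = 0}"
    using ker unfolding finite_index_def by (elim exE conjE)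
  have "\<exists>t\<in>(\<lambda>(s, u). s + u) ` (S \<times> U). x - t \<in> H" if x: "x \<in> G" for x
  proof -
    obtain s h where s: "s \<in> S" "h \<in> H" "f x - f s = f h"
      using T(3)[rule_format, OF imageI[OF x]] unfolding S(3) by blast
    have "x - s - h \<in> G" using x s(1,2) S(1) H(2) by (intro add_subgroup_diff[OF G]) auto
    moreover have "f (x - s - h) = 0" using s(3) by (simp add: f)
    ultimately obtain u where u: "u \<in> U" "x - s - h - u \<in> H"
      using U(3)[rule_format, of "x - s - h"] by auto
    have "x - (s + u) \<in> H"
      using add_subgroup_add[OF H(1) u(2) s(2)] by (simp add: algebra_simps)
    then show ?thesis using s(1) u(1) by (intro bexI[of _ "s + u"]) auto
  qed
  moreover have "(\<lambda>(s, u). s + u) ` (S \<times> U) \<subseteq> G"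
    using S(1) U(2) by (auto intro: add_subgroup_add[OF G])
  ultimately show ?thesis
    unfolding finite_index_def using S(2) U(1)
    by (intro exI[of _ "(\<lambda>(s, u). s + u) ` (S \<times> U)"]) auto
qed

section \<open>Dimension\<close>

context additive_setting
begin

section \<open>Basic \<open>q\<close>-varieties and irreducibility\<close>

lemma q_variety_subgroup:
  fixes V :: "('a ^ 'n) set"
  assumes "q_variety q V"
  shows "add_subgroup V"
proof -
  obtain S where S: "S \<subseteq> Lambda q" "V = {x. \<forall>g\<in>S. g x = 0}"
    using assms unfolding q_variety_def by blast
  then have "g 0 = 0" if "g \<in> S" for g using that Lambda_at_0 by blast
  moreover have "g (x - y) = 0" if "g \<in> S" "x \<in> V" "y \<in> V" for g x y
  proof -
    have "g \<in> Lambda q" "g x = 0" "g y = 0" using that S by blast+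
    then show ?thesis using Lambda_diff[of g x y] by simp
  qed
  ultimately show ?thesis
    unfolding add_subgroup_def using S(2) by blast
qed

lemma q_variety_Int:
  assumes "q_variety q V" "q_variety q W"
  shows "q_variety q (V \<inter> W)"
proof -
  obtain S where S: "S \<subseteq> Lambda q" "V = {x. \<forall>g\<in>S. g x = 0}"
    using assms(1) unfolding q_variety_def by blast
  obtain S' where S': "S' \<subseteq> Lambda q" "W = {x. \<forall>g\<in>S'. g x = 0}"
    using assms(2) unfolding q_variety_def by blast
  show ?thesis unfolding q_variety_def using S S' by (intro exI[of _ "S \<union> S'"]) auto
qed

lemma q_variety_kernel: "f \<in> Lambda q \<Longrightarrow> q_variety q {x. f x = 0}"
  unfolding q_variety_def by (intro exI[of _ "{f}"]) auto

lemma q_variety_UNIV: "q_variety q UNIV"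
  unfolding q_variety_def by (intro exI[of _ "{}"]) auto

lemma q_variety_coordinates: "q_variety q {x :: 'a ^ 'n. \<forall>i\<in>I. x $ i = 0}"
  unfolding q_variety_def using Lambda_coordinate
  by (intro exI[of _ "(\<lambda>i x. x $ i) ` I"]) auto

lemma q_variety_zero: "q_variety q {0 :: 'a ^ 'n}"
proof -
  have "{0 :: 'a ^ 'n} = {x. \<forall>i\<in>UNIV. x $ i = 0}" by (auto simp: vec_eq_iff)
  then show ?thesis using q_variety_coordinates[of UNIV] by simp
qed

lemma irreducible_iff:
  "irreducible_q_variety q F \<longleftrightarrow>
    q_variety q F \<and> (\<forall>H. q_variety q H \<and> H \<subseteq> F \<and> finite_index F H \<longrightarrow> H = F)"
  for F :: "('a ^ 'n) set"
  unfolding irreducible_q_variety_def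
  using finite_add_quotient_iff q_variety_subgroup by blast

lemma irreducible_zero: "irreducible_q_variety q {0 :: 'a ^ 'n}"
  unfolding irreducible_iff using q_variety_zero q_variety_subgroup add_subgroup_0 by blast

end

section \<open>Sections, leaves and pivots\<close>

locale dimension_setting = additive_setting q K
  for q :: nat and K :: "'a::alg_closed_field itself" +
  fixes e :: "nat \<Rightarrow> 'n::finite"
  assumes e_bij: "bij_betw e {..<CARD('n)} UNIV"
begin

text \<open>The index type \<open>'n\<close> carries no order, so the enumeration \<open>e\<close>
  decides which coordinates count as the first \<open>k\<close>.\<close>

definition sect :: "('a ^ 'n) set \<Rightarrow> nat \<Rightarrow> ('a ^ 'n) set" where
  "sect V k = {x \<in> V. \<forall>j<k. x $ e j = 0}"

text \<open>For a \<open>q\<close>-variety this is a copy of the successive quotient of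
  \<open>sect V k\<close> by \<open>sect V (Suc k)\<close>.\<close>

definition leaf :: "('a ^ 'n) set \<Rightarrow> nat \<Rightarrow> 'a set" where
  "leaf V k = (\<lambda>x. x $ e k) ` sect V k"

text \<open>The analogue of the pivot positions of an echelon form.\<close>

definition pivots :: "('a ^ 'n) set \<Rightarrow> nat set" where
  "pivots V = {k. k < CARD('n) \<and> infinite (leaf V k)}"

definition dim :: "('a ^ 'n) set \<Rightarrow> nat" where
  "dim V = card (pivots V)"

lemma sect_0: "sect V 0 = V"
  and sect_Suc: "sect V (Suc k) = sect V k \<inter> {x. x $ e k = 0}"
  and sect_mono: "W \<subseteq> V \<Longrightarrow> sect W k \<subseteq> sect V k"
  and sect_antimono: "j \<le> k \<Longrightarrow> sect V k \<subseteq> sect V j"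
  and sect_subset: "sect V k \<subseteq> V"
  by (auto simp: sect_def less_Suc_eq)

lemma q_variety_sect:
  assumes "q_variety q V"
  shows "q_variety q (sect V k)"
proof -
  have "sect V k = V \<inter> {x. \<forall>i\<in>e ` {..<k}. x $ i = 0}" by (auto simp: sect_def)
  then show ?thesis using q_variety_Int[OF assms q_variety_coordinates] by (simp only:)
qed

lemmas subgroup_sect = q_variety_subgroup[OF q_variety_sect]

lemma sect_full:
  assumes "q_variety q V"
  shows "sect V CARD('n) = {0}"
proof -
  have "x = 0" if "\<forall>j<CARD('n). x $ e j = 0" for x :: "'a ^ 'n"
    using e_bij that unfolding vec_eq_iff bij_betw_def by (metis UNIV_I imageE lessThan_iff zero_index)
  then show ?thesis using add_subgroup_0[OF subgroup_sect[OF assms]] unfolding sect_def by blast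
qed

lemma leaf_mono: "W \<subseteq> V \<Longrightarrow> leaf W k \<subseteq> leaf V k"
  unfolding leaf_def using sect_mono by blast

lemma leaf_cases: "q_variety q V \<Longrightarrow> finite (leaf V k) \<or> leaf V k = UNIV"
  unfolding leaf_def by (intro q_variety_image q_variety_sect Lambda_coordinate)

lemma subgroup_leaf:
  assumes "q_variety q V"
  shows "add_subgroup (leaf V k)"
  unfolding add_subgroup_def
proof (intro conjI ballI)
  note G = subgroup_sect[OF assms, of k]
  show "0 \<in> leaf V k"
    unfolding leaf_def using add_subgroup_0[OF G] by (intro image_eqI[of _ _ 0]) auto
  fix s t assume "s \<in> leaf V k" "t \<in> leaf V k"
  then obtain x y where "x \<in> sect V k" "s = x $ e k" "y \<in> sect V k" "t = y $ e k"
    unfolding leaf_def by blast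
  then show "s - t \<in> leaf V k"
    unfolding leaf_def using add_subgroup_diff[OF G] by (intro image_eqI[of _ _ "x - y"]) auto
qed

lemma finite_pivots: "finite (pivots V)"
  and pivots_subset: "pivots V \<subseteq> {..<CARD('n)}"
  unfolding pivots_def by auto

lemma pivots_mono: "W \<subseteq> V \<Longrightarrow> pivots W \<subseteq> pivots V"
  unfolding pivots_def by (auto dest: finite_subset[OF leaf_mono])

lemma dim_mono: "W \<subseteq> V \<Longrightarrow> dim W \<le> dim V"
  unfolding dim_def by (intro card_mono finite_pivots pivots_mono)

lemma dim_le: "dim V \<le> CARD('n)"
  unfolding dim_def using card_mono[OF _ pivots_subset] by fastforce

lemma dim_eq_pivots: "W \<subseteq> V \<Longrightarrow> dim W = dim V \<Longrightarrow> pivots W = pivots V"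
  unfolding dim_def by (intro card_subset_eq finite_pivots pivots_mono)

lemma dim_UNIV: "dim (UNIV :: ('a ^ 'n) set) = CARD('n)"
proof -
  have "y \<in> leaf UNIV k" if "k < CARD('n)" for y k
  proof -
    have "e j \<noteq> e k" if "j < k" for j
      using e_bij that \<open>k < CARD('n)\<close> unfolding bij_betw_def inj_on_def
      by (metis lessThan_iff order.strict_trans order_less_irrefl)
    then have "axis (e k) y \<in> sect UNIV k" unfolding sect_def by (auto simp: axis_def)
    then show ?thesis unfolding leaf_def by (rule rev_image_eqI) (simp add: axis_def)
  qed
  then have "leaf UNIV k = UNIV" if "k < CARD('n)" for k using that by blast
  then have "pivots UNIV = {..<CARD('n)}"
    unfolding pivots_def using infinite_UNIV_alg_closed[where ?'a = 'a] by auto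
  then show ?thesis unfolding dim_def by simp
qed

text \<open>Equal dimension forces equal pivots, so at each index either both leaves are
  \<open>UNIV\<close> or the leaf of \<open>V\<close> is finite. Finite index then passes up the
  filtration by \<open>finite_index_extension\<close>.\<close>

lemma finite_index_if_dim_eq:
  assumes V: "q_variety q V" and W: "q_variety q W" "W \<subseteq> V" and dim: "dim W = dim V"
  shows "finite_index V W"
proof -
  have piv: "pivots W = pivots V" using dim_eq_pivots W dim by blast
  have leaf: "finite_index (leaf V k) (leaf W k)" if "k < CARD('n)" for k
  proof (cases "k \<in> pivots W")
    case True
    then have "leaf W k = UNIV" "leaf V k = UNIV"
      using leaf_cases[of _ k] V W piv unfolding pivots_def by blast+
    then show ?thesis using finite_index_refl[of UNIV] by (simp add: add_subgroup_def)
  next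
    case False
    then have "finite (leaf V k)" using piv that unfolding pivots_def by blast
    then show ?thesis using subgroup_leaf W by (intro finite_imp_finite_index)
  qed
  have "finite_index (sect V k) (sect W k)" if "k \<le> CARD('n)" for k
    using that
  \<comment> \<open>The induction descends from the last section, which is \<open>{0}\<close>, to
    the whole variety at \<open>k = 0\<close>.\<close>
  proof (induction k rule: inc_induct)
    case base
    show ?case unfolding sect_full[OF V] sect_full[OF W(1)]
      by (intro finite_index_refl) (simp add: add_subgroup_def)
  next
    case (step k)
    show ?case
    proof (rule finite_index_extension[OF subgroup_sect[OF W(1)] sect_mono[OF W(2)] subgroup_sect[OF V]])
      show "(x - y) $ e k = x $ e k - y $ e k" for x y :: "'a ^ 'n" by simp
      show "finite_index ((\<lambda>x. x $ e k) ` sect V k) ((\<lambda>x. x $ e k) ` sect W k)"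
        using leaf[OF step.hyps(2)] unfolding leaf_def .
      show "finite_index (sect V k \<inter> {x. x $ e k = 0}) (sect W k \<inter> {x. x $ e k = 0})"
        using step.IH unfolding sect_Suc .
    qed
  qed
  from this[of 0] show ?thesis by (simp add: sect_0)
qed

lemma finite_index_sect:
  assumes "q_variety q V" "q_variety q W" "W \<subseteq> V" "finite_index V W"
  shows "finite_index (sect V k) (sect W k)"
proof -
  have "sect V k \<inter> W = sect W k" using assms(3) unfolding sect_def by auto
  then show ?thesis
    using finite_index_Int[OF assms(4) sect_subset q_variety_subgroup[OF assms(2)] subgroup_sect[OF assms(1)]]
    by metis
qed

text \<open>Finite index is inherited by the sections, and a subgroup of finite index keeps an
  infinite image infinite, so no pivot is lost.\<close>

lemma dim_eq_if_finite_index: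
  assumes "q_variety q V" "q_variety q W" "W \<subseteq> V" "finite_index V W"
  shows "dim W = dim V"
proof -
  have "infinite (leaf W k)" if "infinite (leaf V k)" for k
    using finite_index_infinite_image[OF finite_index_sect[OF assms], of "\<lambda>x. x $ e k"] that
    unfolding leaf_def by simp
  then have "pivots V \<subseteq> pivots W" unfolding pivots_def by blast
  then show ?thesis using pivots_mono[OF assms(3)] unfolding dim_def by simp
qed

lemma irreducible_eq_if_dim_eq:
  assumes "irreducible_q_variety q V" "q_variety q W" "W \<subseteq> V" "dim W = dim V"
  shows "W = V"
  using assms finite_index_if_dim_eq unfolding irreducible_iff by blast

lemma irreducible_dim_less:
  assumes "irreducible_q_variety q V" "q_variety q W" "W \<subset> V"
  shows "dim W < dim V"
  using irreducible_eq_if_dim_eq[OF assms(1,2)] assms(3) dim_mono[of W V] by fastforce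

text \<open>A point of a section of \<open>V\<close> shares its next coordinate with a point of the
  section of \<open>W\<close>; their difference lies one section deeper, where equality is already
  known.\<close>

lemma eq_if_leaves_eq:
  assumes V: "q_variety q V" and W: "q_variety q W" "W \<subseteq> V"
    and leaf: "\<And>k. k < CARD('n) \<Longrightarrow> leaf W k = leaf V k"
  shows "W = V"
proof -
  have "sect V k \<subseteq> sect W k" if "k \<le> CARD('n)" for k
    using that
  proof (induction k rule: inc_induct)
    case base
    show ?case unfolding sect_full[OF V] sect_full[OF W(1)] by simp
  next
    case (step k)
    show ?case
    proof
      fix x assume x: "x \<in> sect V k"
      then obtain y where y: "y \<in> sect W k" "x $ e k = y $ e k"
        using leaf[OF step.hyps(2)] unfolding leaf_def by blast
      have "x - y \<in> sect V (Suc k)"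
        using add_subgroup_diff[OF subgroup_sect[OF V] x] y sect_mono[OF W(2)]
        unfolding sect_Suc by auto
      then have "x - y \<in> sect W k" using step.IH sect_antimono[of k "Suc k" W] by auto
      then show "x \<in> sect W k"
        using add_subgroup_add[OF subgroup_sect[OF W(1)] _ y(1)] by fastforce
    qed
  qed
  from this[of 0] show ?thesis using W(2) by (simp add: sect_0)
qed

text \<open>The identity component is found by minimising the sizes of the finite leaves; infinite leaves
  contribute \<open>card UNIV = 0\<close>.\<close>

lemma identity_component:
  assumes "q_variety q V"
  obtains G where "irreducible_q_variety q G" "G \<subseteq> V" "dim G = dim V"
proof -
  define P where "P G \<longleftrightarrow> q_variety q G \<and> G \<subseteq> V \<and> dim G = dim V" for G
  define m where "m G = (\<Sum>k<CARD('n). card (leaf G k))" for G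
  have "P V" unfolding P_def using assms by blast
  then obtain G where G: "P G" and min: "\<And>H. P H \<Longrightarrow> m G \<le> m H"
    using ex_has_least_nat[of P V m] by blast
  have "irreducible_q_variety q G"
    unfolding irreducible_iff
  proof (intro conjI allI impI)
    show "q_variety q G" using G unfolding P_def by blast
    fix H assume H: "q_variety q H \<and> H \<subseteq> G \<and> finite_index G H"
    then have dim: "dim H = dim G" using dim_eq_if_finite_index \<open>q_variety q G\<close> by blast
    then have "P H" using H G unfolding P_def by auto
    have inf: "infinite (leaf H k)" if "k < CARD('n)" "infinite (leaf G k)" for k
      using dim_eq_pivots[OF _ dim] H that unfolding pivots_def by blast
    have le: "card (leaf H k) \<le> card (leaf G k)" if "k < CARD('n)" for k
      using inf[OF that] leaf_mono[of H G k] H card_mono by (cases "finite (leaf G k)") auto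
    have "card (leaf H k) = card (leaf G k)" if "k < CARD('n)" for k
    proof (rule ccontr)
      assume "card (leaf H k) \<noteq> card (leaf G k)"
      then have "m H < m G"
        unfolding m_def using le that by (intro sum_strict_mono_ex1) (auto intro!: bexI[of _ k] simp: order_less_le)
      then show False using min[OF \<open>P H\<close>] by simp
    qed
    \<comment> \<open>Finite leaves agree by inclusion and equal cardinality; infinite ones are both
      \<open>UNIV\<close> by \<open>leaf_cases\<close>.\<close>
    then have "leaf H k = leaf G k" if "k < CARD('n)" for k
      using that inf[OF that] leaf_mono[of H G k] H \<open>q_variety q G\<close> leaf_cases[of _ k]
      by (metis card_subset_eq)
    then show "H = G" using eq_if_leaves_eq[OF \<open>q_variety q G\<close>] H by blast
  qed
  then show ?thesis using that G unfolding P_def by blast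
qed

text \<open>\<open>G\<close> has finite index in \<open>V\<close>, hence \<open>C \<inter> G\<close>
  has finite index in \<open>C\<close>, and irreducibility leaves no room for a proper subvariety of
  finite index.\<close>

lemma irreducible_subset_component:
  assumes C: "irreducible_q_variety q C" "C \<subseteq> V"
    and G: "q_variety q G" "G \<subseteq> V" "dim G = dim V" and V: "q_variety q V"
  shows "C \<subseteq> G"
proof -
  have "q_variety q C" using C irreducible_iff by blast
  have "finite_index C (C \<inter> G)"
    using finite_index_Int[OF finite_index_if_dim_eq[OF V G] C(2)] q_variety_subgroup G(1) \<open>q_variety q C\<close>
    by blast
  moreover have "q_variety q (C \<inter> G)" using q_variety_Int \<open>q_variety q C\<close> G(1) by blast
  ultimately have "C \<inter> G = C" using C(1) unfolding irreducible_iff by blast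
  then show ?thesis by blast
qed

text \<open>The images of the sections under \<open>f\<close> shrink from \<open>UNIV\<close> to
  finite at one index \<open>j\<close> at most. Past \<open>j\<close> the kernel has finite index in
  the section; before \<open>j\<close> the value of \<open>f\<close> can be corrected inside the
  next section without touching coordinate \<open>k\<close>. So only the pivot \<open>j\<close> can
  be lost.\<close>

lemma dim_hypersurface:
  assumes V: "q_variety q V" and f: "f \<in> Lambda q"
  shows "dim V \<le> dim (V \<inter> {x. f x = 0}) + 1"
proof -
  define G where "G = V \<inter> {x. f x = 0}"
  have G: "q_variety q G" unfolding G_def using V f by (intro q_variety_Int q_variety_kernel)
  have fd: "f (x - y) = f x - f y" for x y using Lambda_diff[OF f] .
  have G_sect: "sect V k \<inter> {x. f x = 0} = sect G k" for k unfolding G_def sect_def by auto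
  have above: "infinite (leaf G k)" if "finite (f ` sect V k)" "infinite (leaf V k)" for k
    using finite_index_infinite_image[OF finite_index_kernel[OF subgroup_sect[OF V] fd that(1)], of "\<lambda>x. x $ e k"]
      that(2) unfolding G_sect leaf_def by simp
  have below: "infinite (leaf G k)" if "infinite (f ` sect V (Suc k))" "infinite (leaf V k)" for k
  proof -
    have surj: "f ` sect V (Suc k) = UNIV"
      using q_variety_image[OF q_variety_sect[OF V] f] that(1) by blast
    have "leaf V k \<subseteq> leaf G k"
    proof
      fix s assume "s \<in> leaf V k"
      then obtain x where x: "x \<in> sect V k" "s = x $ e k" unfolding leaf_def by blast
      obtain y where y: "y \<in> sect V (Suc k)" "f y = f x" using surj by (metis UNIV_I imageE)
      have "x - y \<in> sect V k"
        using add_subgroup_diff[OF subgroup_sect[OF V] x(1)] y(1) sect_antimono[of k "Suc k" V] by auto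
      then have "x - y \<in> sect G k" unfolding G_sect[symmetric] using y(2) fd by simp
      moreover have "s = (x - y) $ e k" using x(2) y(1) unfolding sect_Suc by simp
      ultimately show "s \<in> leaf G k" unfolding leaf_def by blast
    qed
    then show ?thesis using that(2) finite_subset by blast
  qed
  have "\<exists>j. pivots V \<subseteq> insert j (pivots G)"
  proof (cases "finite (f ` V)")
    case True
    then have "finite (f ` sect V k)" for k using sect_subset by (meson finite_subset image_mono)
    then show ?thesis using above unfolding pivots_def by blast
  next
    case False
    define j where "j = (LEAST k. finite (f ` sect V (Suc k)))"
    have "finite (f ` sect V CARD('n))" unfolding sect_full[OF V] by simp
    \<comment> \<open>The index set is nonempty, so \<open>CARD('n) - 1\<close> witnesses the
      \<open>LEAST\<close>: the section after it is \<open>{0}\<close>.\<close>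
    then have ex: "finite (f ` sect V (Suc (CARD('n) - 1)))" by simp
    have j: "finite (f ` sect V (Suc j))" unfolding j_def by (rule LeastI[of _ "CARD('n) - 1"]) (rule ex)
    have small: "infinite (f ` sect V (Suc k))" if "k < j" for k
      using not_less_Least that unfolding j_def by blast
    have large: "finite (f ` sect V k)" if "j < k" for k
      using j sect_antimono[of "Suc j" k V] that by (meson Suc_leI finite_subset image_mono)
    have "k \<in> pivots G" if "k \<in> pivots V" "k \<noteq> j" for k
      using that above large below small unfolding pivots_def by (metis (mono_tags, lifting) mem_Collect_eq nat_neq_iff)
    then show ?thesis by blast
  qed
  then obtain j where "pivots V \<subseteq> insert j (pivots G)" by blast
  then have "card (pivots V) \<le> card (insert j (pivots G))"
    by (intro card_mono) (auto simp: finite_pivots)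
  also have "\<dots> \<le> card (pivots G) + 1" by (simp add: card_insert_if finite_pivots)
  finally show ?thesis unfolding dim_def G_def .
qed

text \<open>Cut \<open>V\<close> by an equation of \<open>W\<close> that fails on \<open>V\<close>.
  The identity component of the result contains \<open>W\<close>, and its dimension is at least
  \<open>dim V - 1\<close>, which still exceeds \<open>dim W\<close>.\<close>

lemma irreducible_between:
  assumes V: "irreducible_q_variety q V" and W: "irreducible_q_variety q W" "W \<subset> V"
    and gap: "dim W + 1 < dim V"
  obtains G where "irreducible_q_variety q G" "W \<subset> G" "G \<subset> V"
proof -
  have qV: "q_variety q V" and qW: "q_variety q W" using V W irreducible_iff by blast+
  obtain S where S: "S \<subseteq> Lambda q" "W = {x. \<forall>g\<in>S. g x = 0}"
    using qW unfolding q_variety_def by blast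
  obtain f where f: "f \<in> S" "\<not> V \<subseteq> {x. f x = 0}" using S W(2) by blast
  define H where "H = V \<inter> {x. f x = 0}"
  have H: "q_variety q H" unfolding H_def using qV S f by (intro q_variety_Int q_variety_kernel) auto
  have "H \<subset> V" unfolding H_def using f(2) by blast
  have "W \<subseteq> H" unfolding H_def using W(2) S(2) f(1) by blast
  obtain G where G: "irreducible_q_variety q G" "G \<subseteq> H" "dim G = dim H"
    using identity_component[OF H] by blast
  have "W \<subseteq> G"
    using irreducible_subset_component[OF W(1) \<open>W \<subseteq> H\<close> _ G(2,3) H] G(1) irreducible_iff by blast
  moreover have "dim W < dim G"
    using dim_hypersurface[OF qV, of f] S(1) f(1) gap G(3) unfolding H_def by auto
  ultimately show ?thesis using that G(1,2) \<open>H \<subset> V\<close> by blast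
qed

section \<open>Chains\<close>

lemma chain_dim_le:
  assumes "sorted_wrt (\<subset>) Cs" "Cs \<noteq> []" "\<forall>C\<in>set Cs. irreducible_q_variety q C"
  shows "dim (hd Cs) + (length Cs - 1) \<le> dim (last Cs)"
  using assms
proof (induction Cs rule: induct_list012)
  case (3 C D Cs)
  have "q_variety q C" using 3(5) irreducible_iff by auto
  then have "dim C < dim D" using 3(3,5) by (intro irreducible_dim_less) auto
  then show ?case using 3 by auto
qed auto

lemma q_chain_length_le:
  assumes "q_chain q V Cs"
  shows "chain_length Cs \<le> dim V"
proof -
  have "chain_length Cs \<le> dim (last Cs)"
    using chain_dim_le[of Cs] assms unfolding q_chain_def chain_length_def by auto
  also have "\<dots> \<le> dim V" using assms unfolding q_chain_def by (intro dim_mono) auto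
  finally show ?thesis .
qed

lemma saturated_chain_dim:
  assumes "Cs \<noteq> []" "\<And>xs A B ys. Cs = xs @ A # B # ys \<Longrightarrow> dim B \<le> dim A + 1"
  shows "dim (last Cs) \<le> dim (hd Cs) + (length Cs - 1)"
  using assms
proof (induction Cs rule: induct_list012)
  case (3 C D Cs)
  have "dim D \<le> dim C + 1" using 3(4)[of "[]"] by simp
  moreover have "dim (last (D # Cs)) \<le> dim D + length Cs"
    using 3(2) 3(4)[of "C # _"] by (metis append_Cons diff_Suc_1 length_Cons list.sel(1) list.simps(3))
  ultimately show ?case by simp
qed auto

text \<open>Maximality forbids prepending \<open>{0}\<close>, appending the identity component of
  \<open>V\<close>, and filling a jump of two or more. So the dimensions run from 0 to
  \<open>dim V\<close> in steps of one.\<close>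

lemma maximal_q_chain_length:
  assumes V: "q_variety q V" and max: "maximal_q_chain q V Cs"
  shows "chain_length Cs = dim V"
proof -
  have Cs: "Cs \<noteq> []" "sorted_wrt (\<subset>) Cs" "\<And>C. C \<in> set Cs \<Longrightarrow> irreducible_q_variety q C"
    "\<And>C. C \<in> set Cs \<Longrightarrow> C \<subseteq> V"
    using max unfolding maximal_q_chain_def q_chain_def by auto
  have refine: "False" if "q_chain q V Ds" "set Cs \<subset> set Ds" for Ds
    using max that unfolding maximal_q_chain_def by blast
  have zero: "0 \<in> C" if "irreducible_q_variety q C" for C :: "('a ^ 'n) set"
    using that irreducible_iff q_variety_subgroup add_subgroup_0 by blast
  have hd: "hd Cs = {0}"
  proof (rule ccontr)
    assume "hd Cs \<noteq> {0}"
    have hd_sub: "hd Cs \<subseteq> C" if "C \<in> set Cs" for C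
      using Cs(1,2) that by (cases Cs) auto
    have "{0} \<subset> hd Cs"
      using zero[OF Cs(3)[OF hd_in_set[OF Cs(1)]]] \<open>hd Cs \<noteq> {0}\<close> by auto
    then have less: "{0} \<subset> C" if "C \<in> set Cs" for C
      using hd_sub[OF that] by (rule psubset_subset_trans)
    have "{0} \<subseteq> V" using add_subgroup_0[OF q_variety_subgroup[OF V]] by simp
    moreover have "sorted_wrt (\<subset>) ({0} # Cs)" using Cs(2) less by simp
    ultimately have "q_chain q V ({0} # Cs)"
      unfolding q_chain_def by (simp add: Cs(3,4) irreducible_zero)
    moreover have "{0} \<notin> set Cs" using less by blast
    ultimately show False using refine[of "{0} # Cs"] by auto
  qed
  have "dim (last Cs) = dim V"
  proof (rule ccontr)
    assume neq: "dim (last Cs) \<noteq> dim V"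
    obtain G where G: "irreducible_q_variety q G" "G \<subseteq> V" "dim G = dim V"
      using identity_component[OF V] by blast
    have qG: "q_variety q G" using G irreducible_iff by blast
    have le_last: "C \<subseteq> last Cs" if "C \<in> set Cs" for C
      using Cs(1,2) that by (induction Cs rule: rev_induct) (auto simp: sorted_wrt_append)
    \<comment> \<open>\<open>G\<close> contains every member of the chain, and it differs from the
      last one because the dimensions differ.\<close>
    have less: "C \<subset> G" if "C \<in> set Cs" for C
      using irreducible_subset_component[OF Cs(3,4)[OF that] qG G(2,3) V]
        irreducible_subset_component[OF Cs(3,4)[OF last_in_set[OF Cs(1)]] qG G(2,3) V]
        le_last[OF that] neq G(3) by auto
    have "sorted_wrt (\<subset>) (Cs @ [G])" using Cs(2) less by (simp add: sorted_wrt_append)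
    then have "q_chain q V (Cs @ [G])"
      unfolding q_chain_def using G(1,2) Cs(3,4) by simp
    moreover have "G \<notin> set Cs" using less by blast
    ultimately show False using refine[of "Cs @ [G]"] by auto
  qed
  moreover have "dim B \<le> dim A + 1" if split: "Cs = xs @ A # B # ys" for xs A B ys
  proof (rule ccontr)
    assume "\<not> dim B \<le> dim A + 1"
    then have "dim A + 1 < dim B" by simp
    moreover have "A \<subset> B" using Cs(2) unfolding split by (simp add: sorted_wrt_append)
    moreover have "irreducible_q_variety q A" "irreducible_q_variety q B" using Cs(3) split by simp_all
    ultimately obtain G where G: "irreducible_q_variety q G" "A \<subset> G" "G \<subset> B"
      using irreducible_between[of B A] by metis
    have below: "C \<subset> G" if "C \<in> set xs" for C
      using Cs(2) that unfolding split by (intro psubset_trans[OF _ G(2)]) (simp add: sorted_wrt_append)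
    have above: "G \<subset> C" if "C \<in> set ys" for C
      using Cs(2) that unfolding split by (intro psubset_trans[OF G(3)]) (simp add: sorted_wrt_append)
    have "sorted_wrt (\<subset>) (xs @ A # G # B # ys)"
      using Cs(2) G(2,3) below above unfolding split by (simp add: sorted_wrt_append)
    moreover have "G \<subseteq> V" using psubset_imp_subset[OF G(3)] Cs(4)[of B] split by simp
    ultimately have chain: "q_chain q V (xs @ A # G # B # ys)"
      unfolding q_chain_def using Cs(3,4) G(1) split by simp
    have "G \<notin> set Cs"
      using below above G(2,3) unfolding split by auto
    then show False using refine[OF chain] split by auto
  qed
  then have "dim (last Cs) \<le> dim (hd Cs) + (length Cs - 1)"
    using saturated_chain_dim[OF Cs(1)] by blast
  moreover have "dim (hd Cs) = 0"
  proof -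
    have "leaf {0} k \<subseteq> {0}" for k unfolding leaf_def sect_def by auto
    then have "finite (leaf {0} k)" for k by (rule finite_subset) simp
    then have "pivots {0} = {}" unfolding pivots_def by simp
    then show ?thesis unfolding hd dim_def by simp
  qed
  moreover have "chain_length Cs \<le> dim V"
    using max unfolding maximal_q_chain_def by (intro q_chain_length_le) simp
  ultimately show ?thesis unfolding chain_length_def by simp
qed

lemma q_chain_zero:
  assumes "q_variety q V"
  shows "q_chain q V [{0 :: 'a ^ 'n}]"
  unfolding q_chain_def using irreducible_zero add_subgroup_0[OF q_variety_subgroup[OF assms]] by simp

text \<open>A longest chain exists by the bound \<open>dim V\<close>, and it cannot be refined, so
  the length of maximal chains is attained.\<close>

lemma q_dim_eq_dim:
  assumes V: "q_variety q V"
  shows "q_dim q V = dim V"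
proof -
  obtain Cs where Cs: "q_chain q V Cs" and longest: "\<And>Ds. q_chain q V Ds \<Longrightarrow> chain_length Ds \<le> chain_length Cs"
    using ex_has_greatest_nat[of "q_chain q V" "[{0}]" chain_length "Suc (dim V)"] q_chain_zero[OF V] q_chain_length_le
    by (metis less_Suc_eq_le)
  \<comment> \<open>Refinement compares sets of members while length counts list entries; strict
    inclusions make the entries distinct, and the two counts differ by one.\<close>
  have card_eq: "card (set Ds) = Suc (chain_length Ds)" if "q_chain q V Ds" for Ds
  proof -
    have "distinct Ds"
      using that sorted_wrt_mono_rel[of Ds "(\<subset>)" "(\<noteq>)"] distinct_conv_nth
      unfolding q_chain_def by (auto simp: sorted_wrt_iff_nth_less distinct_conv_nth) (metis nat_neq_iff psubset_eq)
    then show ?thesis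
      using that unfolding q_chain_def chain_length_def by (simp add: distinct_card)
  qed
  have "maximal_q_chain q V Cs"
    unfolding maximal_q_chain_def
  proof (intro conjI notI Cs)
    assume "\<exists>Ds. q_chain q V Ds \<and> set Cs \<subset> set Ds"
    then obtain Ds where "q_chain q V Ds" "set Cs \<subset> set Ds" by blast
    then show False
      using longest[of Ds] psubset_card_mono[of "set Ds" "set Cs"] card_eq Cs by auto
  qed
  then have "chain_length Cs = dim V" by (rule maximal_q_chain_length[OF V])
  then show ?thesis
    unfolding q_dim_def using Cs q_chain_length_le
    by (intro Max_eqI) (auto intro: finite_subset[of _ "{..dim V}"] intro!: exI[of _ Cs])
qed

end

theorem theorem4p8:
  fixes p q :: nat
    and F :: "('a::alg_closed_field ^ 'n) set"
  assumes "prime p"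
    and "CHAR('a) = p"
    and "\<exists>r \<ge> 1. q = p ^ r"
    and "q_variety q F"
  shows "(\<forall>Cs. q_chain q F Cs \<longrightarrow> chain_length Cs \<le> CARD('n)) \<and>
    (\<forall>Cs Ds. maximal_q_chain q F Cs \<and> maximal_q_chain q F Ds \<longrightarrow>
       chain_length Cs = chain_length Ds) \<and>
    q_dim q (UNIV :: ('a ^ 'n) set) = CARD('n)"
proof -
  \<comment> \<open>Any enumeration of the coordinates will do, as the claims do not mention
    \<open>e\<close>.\<close>
  obtain e :: "nat \<Rightarrow> 'n" where "bij_betw e {..<CARD('n)} UNIV"
    using ex_bij_betw_nat_finite[of "UNIV :: 'n set"] by (auto simp: atLeast0LessThan)
  then interpret dimension_setting q "TYPE('a)" e
    using assms by unfold_locales auto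
  show ?thesis
  proof (intro conjI allI impI)
    show "chain_length Cs \<le> CARD('n)" if "q_chain q F Cs" for Cs
      using q_chain_length_le[OF that] dim_le[of F] by simp
    show "chain_length Cs = chain_length Ds"
      if "maximal_q_chain q F Cs \<and> maximal_q_chain q F Ds" for Cs Ds
      using that maximal_q_chain_length[OF assms(4)] by simp
    show "q_dim q (UNIV :: ('a ^ 'n) set) = CARD('n)"
      using q_dim_eq_dim[OF q_variety_UNIV] dim_UNIV by simp
  qed
qed

end
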